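(* On $\beta(0,1)$-trees with $n$ nodes, the pair of statistics $(\mathrm{root},\mathrm{open})$ has the same joint distribution as the pair $(\mathrm{open},\mathrm{root})$. Equivalently, $$\sum_{T}x^{\mathrm{root}(T)}y^{\mathrm{open}(T)} = \sum_{T}x^{\mathrm{open}(T)}y^{\mathrm{root}(T)},$$ where both sums are over all $\beta(0,1)$-trees $T$ with $n$ nodes.
   Context: A $\beta(0,1)$-tree is a rooted plane tree (children linearly ordered left to right) whose nodes are labeled with nonnegative integers such that: leaves have label $0$; the label of the root is one more than the sum of its children's labels; the label of any other (non-leaf) node exceeds the sum of its children's labels by at most one. The trivial tree $\bullet$ has one node, whose label is $0$; all others are nontrivial. $\mathrm{root}(T)$ is the root label of $T$ (so $\mathrm{root}(\bullet)=0$). The rightmost path is the path from the root to the rightmost leaf. A non-root node is excessive if its label exceeds the sum of its children's labels, and moderate otherwise (leaves are moderate); the root of a nontrivial tree is excessive. In a nontrivial tree, a node on the rightmost path (possibly the root) is open if its rightmost child, if any, is a non-leaf moderate node; in particular the rightmost leaf is open. $\mathrm{open}(T)$ is the number of open nodes of $T$, with $\mathrm{open}(\bullet)=0$. *)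

theory Defs
  imports Main
begin

datatype ltree = Node (label: nat) (children: "ltree list")

fun num_nodes :: "ltree \<Rightarrow> nat" where
  "num_nodes (Node l ts) = 1 + sum_list (map num_nodes ts)"

definition child_sum :: "ltree \<Rightarrow> nat" where
  "child_sum t = sum_list (map label (children t))"

text \<open>The condition imposed on a subtree that hangs strictly below the root. The label of a
  non-leaf node may be smaller than the sum of its children's labels.\<close>

fun valid_below_root :: "ltree \<Rightarrow> bool" where
  "valid_below_root (Node l ts) \<longleftrightarrow>
     (if ts = [] then l = 0 else l \<le> child_sum (Node l ts) + 1) \<and>
     (\<forall>t\<in>set ts. valid_below_root t)"

text \<open>The trivial tree is \<^term>\<open>Node 0 []\<close>; its only node is treated as a leaf.\<close>

definition beta01_tree :: "ltree \<Rightarrow> bool" where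
  "beta01_tree T \<longleftrightarrow>
     (if children T = [] then label T = 0 else label T = child_sum T + 1) \<and>
     (\<forall>t\<in>set (children T). valid_below_root t)"

definition beta01_trees :: "nat \<Rightarrow> ltree set" where
  "beta01_trees n = {T. beta01_tree T \<and> num_nodes T = n}"

text \<open>Nodes are represented by the subtrees rooted at them. The root of a nontrivial tree
  in \<^const>\<open>beta01_tree\<close> is excessive according to this definition as well.\<close>

definition excessive :: "ltree \<Rightarrow> bool" where
  "excessive t \<longleftrightarrow> label t > child_sum t"

definition moderate :: "ltree \<Rightarrow> bool" where
  "moderate t \<longleftrightarrow> \<not> excessive t"

function rightmost_path :: "ltree \<Rightarrow> ltree list" where
  "rightmost_path (Node l ts) =
     Node l ts # (if ts = [] then [] else rightmost_path (last ts))"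
  by pat_completeness auto
termination
proof (relation "measure size")
  fix l :: nat and ts :: "ltree list"
  assume "ts \<noteq> []"
  then have "last ts \<in> set ts"
    by simp
  then have "size (last ts) \<le> size_list size ts"
    by (rule size_list_estimation') simp
  then show "(last ts, Node l ts) \<in> measure size"
    by simp
qed simp

definition open_node :: "ltree \<Rightarrow> bool" where
  "open_node t \<longleftrightarrow>
     (children t \<noteq> [] \<longrightarrow> children (last (children t)) \<noteq> [] \<and> moderate (last (children t)))"

definition root_label :: "ltree \<Rightarrow> nat" where
  "root_label T = label T"

definition num_open :: "ltree \<Rightarrow> nat" where
  "num_open T =
     (if children T = [] then 0 else length (filter open_node (rightmost_path T)))"

text \<open>Finiteness of \<^term>\<open>beta01_trees n\<close>, so that sums and cardinalities over it are meaningful.\<close>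

lemma num_nodes_pos: "num_nodes t > 0"
  by (cases t) simp

lemma label_less_num_nodes: "valid_below_root t \<Longrightarrow> label t < num_nodes t"
proof (induction t)
  case (Node l ts)
  have "sum_list (map label ts) + length ts \<le> sum_list (map num_nodes ts)"
    if "\<forall>t\<in>set ts. label t < num_nodes t" for ts
    using that by (induction ts) auto
  moreover have "\<forall>t\<in>set ts. label t < num_nodes t"
    using Node by auto
  ultimately have "sum_list (map label ts) + length ts \<le> sum_list (map num_nodes ts)"
    by blast
  then show ?case
    using Node.prems by (cases ts) (auto simp: child_sum_def)
qed

lemma num_nodes_children:
  "length ts \<le> sum_list (map num_nodes ts)"
  "t \<in> set ts \<Longrightarrow> num_nodes t \<le> sum_list (map num_nodes ts)"
proof -
  show "length ts \<le> sum_list (map num_nodes ts)"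
  proof (induction ts)
    case (Cons a ts)
    then show ?case using num_nodes_pos[of a] by simp
  qed simp
  show "t \<in> set ts \<Longrightarrow> num_nodes t \<le> sum_list (map num_nodes ts)"
    by (induction ts) auto
qed

lemma finite_valid_below_root: "finite {t. valid_below_root t \<and> num_nodes t \<le> n}"
proof (induction n)
  case 0
  have "{t. valid_below_root t \<and> num_nodes t \<le> 0} = {}"
    using num_nodes_pos by (auto simp: not_le)
  then show ?case by (metis finite.emptyI)
next
  case (Suc n)
  let ?S = "{t. valid_below_root t \<and> num_nodes t \<le> n}"
  let ?L = "{ts. set ts \<subseteq> ?S \<and> length ts \<le> n}"
  have "{t. valid_below_root t \<and> num_nodes t \<le> Suc n}
      \<subseteq> (\<lambda>(l, ts). Node l ts) ` ({..n} \<times> ?L)"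
  proof
    fix t assume t: "t \<in> {t. valid_below_root t \<and> num_nodes t \<le> Suc n}"
    obtain l ts where eq: "t = Node l ts" by (cases t)
    have "l \<le> n"
    proof -
      have "label t < num_nodes t" "num_nodes t \<le> Suc n"
        using t label_less_num_nodes by blast+
      then show ?thesis
        using eq by simp
    qed
    moreover have "sum_list (map num_nodes ts) \<le> n" and "\<forall>u\<in>set ts. valid_below_root u"
      using t eq by auto
    then have "ts \<in> ?L"
      using num_nodes_children le_trans by blast
    ultimately show "t \<in> (\<lambda>(l, ts). Node l ts) ` ({..n} \<times> ?L)"
      using eq by auto
  qed
  moreover have "finite ({..n} \<times> ?L)"
    using Suc by (simp add: finite_lists_length_le)
  ultimately show ?case
    by (meson finite_imageI finite_subset)
qed

lemma finite_beta01_trees: "finite (beta01_trees n)"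
proof (rule finite_subset)
  show "beta01_trees n \<subseteq> {t. valid_below_root t \<and> num_nodes t \<le> n}"
  proof
    fix t assume "t \<in> beta01_trees n"
    then show "t \<in> {t. valid_below_root t \<and> num_nodes t \<le> n}"
      by (cases t) (auto simp: beta01_trees_def beta01_tree_def child_sum_def split: if_splits)
  qed
qed (rule finite_valid_below_root)

end

theory Submission
  imports Defs "HOL-Computational_Algebra.Formal_Power_Series" "HOL-Computational_Algebra.Polynomial"
begin

text \<open>Let \<open>F(x, y)\<close> be the generating function of nontrivial trees by \<open>root\<close> and \<open>open\<close>, as a power
  series in a variable \<open>t\<close> marking edges, and put \<open>A(y) = F(1, y)\<close>, \<open>B(x) = F(x, 1)\<close> and
  \<open>C = F(1, 1)\<close>. Detaching the leftmost subtree of the root gives a functional equation, and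
  combining it with its instance \<open>y = 1\<close> yields
  \<open>F(x, y) (x - 1 - C - (y - 1) B(x)) = y B(x) (x - 1 - A(y))\<close>, together with a quadratic equation
  for \<open>B(x)\<close>. The power series \<open>x = 1 + A(y)\<close> annihilates the right-hand side, hence the kernel on
  the left: \<open>A(y) = C + (y - 1) B(1 + A(y))\<close>. Inserting this into the quadratic equation for
  \<open>B(1 + A(y))\<close> shows that \<open>A(y)\<close> satisfies the same quadratic equation as \<open>B(y)\<close>. This equation has only
  one power series solution, so \<open>A = B\<close>, and then \<open>F(x, y) = F(y, x)\<close> is an
  algebraic consequence of the two equations.\<close>

unbundle fps_syntax

subsection \<open>Generating functions of graded sets\<close>

text \<open>\<open>sum\<close> over an infinite set is \<open>0\<close>, so the laws for generating
  functions of unions and products rely on finite levels.\<close>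

definition graded :: "('b \<Rightarrow> nat) \<Rightarrow> 'b set \<Rightarrow> bool" where
  "graded s S \<longleftrightarrow> (\<forall>n. finite {a \<in> S. s a = n})"

definition gf :: "('b \<Rightarrow> nat) \<Rightarrow> 'b set \<Rightarrow> ('b \<Rightarrow> 'a::comm_ring_1) \<Rightarrow> 'a fps" where
  "gf s S w = Abs_fps (\<lambda>n. \<Sum>a | a \<in> S \<and> s a = n. w a)"

lemma gf_nth: "gf s S w $ n = (\<Sum>a | a \<in> S \<and> s a = n. w a)"
  by (simp add: gf_def)

lemma gf_cong:
  assumes "\<And>a. a \<in> S \<Longrightarrow> w a = w' a"
  shows "gf s S w = gf s S w'"
  by (rule fps_ext) (auto simp: gf_nth intro!: sum.cong assms)

lemma gf_bij:
  assumes "bij_betw f S S'" and "\<And>a. a \<in> S \<Longrightarrow> s' (f a) = s a"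
  shows "gf s' S' w = gf s S (\<lambda>a. w (f a))"
proof (rule fps_ext)
  fix n
  have "bij_betw f {a. a \<in> S \<and> s a = n} {b. b \<in> S' \<and> s' b = n}"
    using assms unfolding bij_betw_def inj_on_def by (auto simp: image_iff)
  then show "gf s' S' w $ n = gf s S (\<lambda>a. w (f a)) $ n"
    unfolding gf_nth by (rule sum.reindex_bij_betw [symmetric])
qed

lemma gf_Un:
  assumes "graded s S" "graded s S'" "S \<inter> S' = {}"
  shows "gf s (S \<union> S') w = gf s S w + gf s S' w"
proof (rule fps_ext)
  fix n
  have "{a. a \<in> S \<union> S' \<and> s a = n} = {a \<in> S. s a = n} \<union> {a \<in> S'. s a = n}"
    by auto
  then show "gf s (S \<union> S') w $ n = (gf s S w + gf s S' w) $ n"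
    using assms unfolding gf_nth fps_add_nth graded_def
    by (auto intro!: sum.union_disjoint)
qed

lemma gf_Times:
  assumes "graded s S" "graded s' S'"
  shows "gf (\<lambda>(a, b). s a + s' b) (S \<times> S') (\<lambda>(a, b). w a * w' b) = gf s S w * gf s' S' w'"
proof (rule fps_ext)
  fix n
  let ?A = "\<lambda>i. {a. a \<in> S \<and> s a = i}" and ?B = "\<lambda>i. {b. b \<in> S' \<and> s' b = i}"
  have fin: "finite (?A i)" "finite (?B i)" for i
    using assms by (auto simp: graded_def)
  have "{p. p \<in> S \<times> S' \<and> (case p of (a, b) \<Rightarrow> s a + s' b) = n} = (\<Union>i\<in>{0..n}. ?A i \<times> ?B (n - i))"
    by auto
  then have "gf (\<lambda>(a, b). s a + s' b) (S \<times> S') (\<lambda>(a, b). w a * w' b) $ n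
      = (\<Sum>i = 0..n. \<Sum>(a, b)\<in>?A i \<times> ?B (n - i). w a * w' b)"
    unfolding gf_nth by (simp only:) (rule sum.UNION_disjoint, use fin in auto)
  also have "\<dots> = (gf s S w * gf s' S' w') $ n"
    by (simp add: fps_mult_nth gf_nth sum_product sum.cartesian_product)
  finally show "gf (\<lambda>(a, b). s a + s' b) (S \<times> S') (\<lambda>(a, b). w a * w' b) $ n = (gf s S w * gf s' S' w') $ n" .
qed

text \<open>The component \<open>b\<close> contributes weight but no size; this fits the choice of a
  root label, which leaves the number of edges unchanged.\<close>

lemma gf_Sigma:
  assumes "graded s S" "\<And>a. a \<in> S \<Longrightarrow> finite (I a)"
  shows "gf (\<lambda>(a, b). s a) (Sigma S I) w = gf s S (\<lambda>a. \<Sum>b\<in>I a. w (a, b))"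
proof (rule fps_ext)
  fix n
  have "{p. p \<in> Sigma S I \<and> (case p of (a, b) \<Rightarrow> s a) = n} = Sigma {a. a \<in> S \<and> s a = n} I"
    by auto
  then show "gf (\<lambda>(a, b). s a) (Sigma S I) w $ n = gf s S (\<lambda>a. \<Sum>b\<in>I a. w (a, b)) $ n"
    using assms by (auto simp: gf_nth graded_def sum.Sigma)
qed

lemma gf_Suc: "gf (\<lambda>a. Suc (s a)) S w = fps_X * gf s S w"
proof (rule fps_ext)
  fix n show "gf (\<lambda>a. Suc (s a)) S w $ n = (fps_X * gf s S w) $ n"
    by (cases n) (simp_all add: gf_nth)
qed

lemma gf_add: "gf s S (\<lambda>a. w a + w' a) = gf s S w + gf s S w'"
  by (rule fps_ext) (simp add: gf_nth sum.distrib)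

lemma gf_cmult: "gf s S (\<lambda>a. c * w a) = fps_const c * gf s S w"
  by (rule fps_ext) (simp add: gf_nth sum_distrib_left)

lemma gf_diff: "gf s S (\<lambda>a. w a - w' a) = gf s S w - gf s S w'"
  by (rule fps_ext) (simp add: gf_nth sum_subtractf)

subsection \<open>Decomposition of trees\<close>

definition subtrees :: "ltree set" where
  "subtrees = {t. valid_below_root t}"

definition nontrivial :: "ltree set" where
  "nontrivial = {T. beta01_tree T \<and> children T \<noteq> []}"

definition edges :: "ltree \<Rightarrow> nat" where
  "edges t = num_nodes t - 1"

lemma num_nodes_eq_Suc_edges: "num_nodes t = Suc (edges t)"
  using num_nodes_pos[of t] by (simp add: edges_def)

lemma num_nodes_neq_0 [simp]: "num_nodes t \<noteq> 0"
  by (simp add: num_nodes_eq_Suc_edges)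

lemma edges_Node: "edges (Node l ts) = sum_list (map num_nodes ts)"
  by (simp add: edges_def)

lemma child_sum_Node: "child_sum (Node l ts) = sum_list (map label ts)"
  by (simp add: child_sum_def)

lemma nontrivial_iff:
  "Node l ts \<in> nontrivial \<longleftrightarrow> ts \<noteq> [] \<and> l = Suc (sum_list (map label ts)) \<and> set ts \<subseteq> subtrees"
  by (auto simp: nontrivial_def beta01_tree_def child_sum_def subtrees_def)

lemma subtrees_iff:
  "Node l ts \<in> subtrees \<longleftrightarrow>
     (if ts = [] then l = 0 else l \<le> Suc (sum_list (map label ts))) \<and> set ts \<subseteq> subtrees"
  by (auto simp: subtrees_def child_sum_def)

lemma nontrivial_subset_subtrees: "nontrivial \<subseteq> subtrees"
proof
  fix T assume "T \<in> nontrivial"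
  then show "T \<in> subtrees" by (cases T) (auto simp: nontrivial_iff subtrees_iff)
qed

lemma graded_edges:
  assumes "S \<subseteq> subtrees"
  shows "graded edges S"
  unfolding graded_def
proof
  fix n
  have "{a \<in> S. edges a = n} \<subseteq> {t. valid_below_root t \<and> num_nodes t \<le> Suc n}"
    using assms by (auto simp: subtrees_def num_nodes_eq_Suc_edges)
  then show "finite {a \<in> S. edges a = n}"
    using finite_valid_below_root finite_subset by blast
qed

lemmas graded_nontrivial = graded_edges[OF nontrivial_subset_subtrees]
lemmas graded_subtrees = graded_edges[OF subset_refl]

text \<open>A non-leaf node below the root may carry any label up to one more than its child sum,
  the value forced on a root. Restoring that value and recording the old label inverts the
  map.\<close>

lemma bij_betw_relabel:
  "bij_betw (\<lambda>(U, i). Node i (children U)) (SIGMA U:nontrivial. {..label U}) {t \<in> subtrees. children t \<noteq> []}"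
proof (rule bij_betw_byWitness[where f' = "\<lambda>t. (Node (Suc (child_sum t)) (children t), label t)"])
  show "\<forall>p\<in>SIGMA U:nontrivial. {..label U}.
      (\<lambda>t. (Node (Suc (child_sum t)) (children t), label t)) ((\<lambda>(U, i). Node i (children U)) p) = p"
  proof
    fix p assume "p \<in> (SIGMA U:nontrivial. {..label U})"
    then obtain l ts i where "p = (Node l ts, i)" "Node l ts \<in> nontrivial"
      by (auto, metis ltree.exhaust)
    then show "(\<lambda>t. (Node (Suc (child_sum t)) (children t), label t)) ((\<lambda>(U, i). Node i (children U)) p) = p"
      by (auto simp: nontrivial_iff child_sum_Node)
  qed
  show "(\<lambda>(U, i). Node i (children U)) ` (SIGMA U:nontrivial. {..label U}) \<subseteq> {t \<in> subtrees. children t \<noteq> []}"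
  proof clarify
    fix U i assume "U \<in> nontrivial" "i \<le> label U"
    then show "Node i (children U) \<in> subtrees \<and> children (Node i (children U)) \<noteq> []"
      by (cases U) (auto simp: nontrivial_iff subtrees_iff)
  qed
  show "(\<lambda>t. (Node (Suc (child_sum t)) (children t), label t)) ` {t \<in> subtrees. children t \<noteq> []}
      \<subseteq> (SIGMA U:nontrivial. {..label U})"
  proof clarify
    fix t assume t: "t \<in> subtrees" "children t \<noteq> []"
    show "Node (Suc (child_sum t)) (children t) \<in> nontrivial \<and>
        label t \<in> {..label (Node (Suc (child_sum t)) (children t))}"
      using t by (cases t) (auto simp: nontrivial_iff subtrees_iff child_sum_Node)
  qed
qed auto

lemma gf_subtrees:
  "gf edges subtrees w
     = fps_const (w (Node 0 [])) + gf edges nontrivial (\<lambda>U. \<Sum>i\<le>label U. w (Node i (children U)))"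
proof -
  have leaf: "{t \<in> subtrees. children t = []} = {Node 0 []}"
  proof (intro equalityI subsetI)
    fix t assume "t \<in> {t \<in> subtrees. children t = []}"
    then show "t \<in> {Node 0 []}" by (cases t) (auto simp: subtrees_iff)
  qed (auto simp: subtrees_iff)
  have "gf edges subtrees w
      = gf edges {t \<in> subtrees. children t = []} w + gf edges {t \<in> subtrees. children t \<noteq> []} w"
    by (subst gf_Un[symmetric]) (auto intro!: graded_edges arg_cong[where f = "\<lambda>S. gf edges S w"])
  also have "gf edges {t \<in> subtrees. children t = []} w = fps_const (w (Node 0 []))"
  proof (rule fps_ext)
    fix n
    have "{a. a \<in> {Node 0 []} \<and> edges a = n} = (if n = 0 then {Node 0 []} else {})"
      by (auto simp: edges_Node)
    then show "gf edges {t \<in> subtrees. children t = []} w $ n = fps_const (w (Node 0 [])) $ n"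
      unfolding leaf gf_nth by simp
  qed
  also have "gf edges {t \<in> subtrees. children t \<noteq> []} w
      = gf (\<lambda>(U, i). edges U) (SIGMA U:nontrivial. {..label U}) (\<lambda>p. w ((\<lambda>(U, i). Node i (children U)) p))"
  proof (rule gf_bij[OF bij_betw_relabel])
    fix p assume "p \<in> (SIGMA U:nontrivial. {..label U})"
    then show "edges (case p of (U, i) \<Rightarrow> Node i (children U)) = (case p of (U, i) \<Rightarrow> edges U)"
      by (cases p; cases "fst p") (auto simp: edges_Node)
  qed
  also have "\<dots> = gf edges nontrivial (\<lambda>U. \<Sum>i\<le>label U. w (Node i (children U)))"
    by (subst gf_Sigma) (auto intro: graded_nontrivial)
  finally show ?thesis .
qed

lemma bij_betw_plant:
  "bij_betw (\<lambda>c. Node (Suc (label c)) [c]) subtrees {T \<in> nontrivial. length (children T) = 1}"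
proof (rule bij_betw_byWitness[where f' = "\<lambda>T. hd (children T)"])
  show "\<forall>T\<in>{T \<in> nontrivial. length (children T) = 1}.
      Node (Suc (label (hd (children T)))) [hd (children T)] = T"
  proof clarify
    fix T assume "T \<in> nontrivial" "length (children T) = 1"
    then show "Node (Suc (label (hd (children T)))) [hd (children T)] = T"
      by (cases T) (auto simp: nontrivial_iff length_Suc_conv)
  qed
  show "(\<lambda>T. hd (children T)) ` {T \<in> nontrivial. length (children T) = 1} \<subseteq> subtrees"
  proof clarify
    fix T assume "T \<in> nontrivial" "length (children T) = 1"
    then show "hd (children T) \<in> subtrees"
      by (cases T) (auto simp: nontrivial_iff length_Suc_conv)
  qed
qed (auto simp: nontrivial_iff)

text \<open>A root label is one more than the child sum, so detaching the leftmost child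
  \<open>c\<close> lowers it by \<open>label c\<close>; if there are at least two children, a
  nontrivial tree remains.\<close>

lemma bij_betw_graft:
  "bij_betw (\<lambda>(c, T). Node (label c + label T) (c # children T)) (subtrees \<times> nontrivial)
     {T \<in> nontrivial. length (children T) \<noteq> 1}"
proof (rule bij_betw_byWitness[where f' = "\<lambda>T. (hd (children T),
        Node (label T - label (hd (children T))) (tl (children T)))"])
  show "\<forall>p\<in>subtrees \<times> nontrivial. (\<lambda>T. (hd (children T),
        Node (label T - label (hd (children T))) (tl (children T))))
        ((\<lambda>(c, T). Node (label c + label T) (c # children T)) p) = p"
    by auto
  show "\<forall>T\<in>{T \<in> nontrivial. length (children T) \<noteq> 1}. (\<lambda>(c, T). Node (label c + label T) (c # children T))
      (hd (children T), Node (label T - label (hd (children T))) (tl (children T))) = T"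
  proof
    fix T assume T: "T \<in> {T \<in> nontrivial. length (children T) \<noteq> 1}"
    obtain l c ts where "T = Node l (c # ts)"
      using T by (cases T, cases "children T") (auto simp: nontrivial_iff)
    then show "(\<lambda>(c, T). Node (label c + label T) (c # children T))
      (hd (children T), Node (label T - label (hd (children T))) (tl (children T))) = T"
      using T by (auto simp: nontrivial_iff)
  qed
  show "(\<lambda>(c, T). Node (label c + label T) (c # children T)) ` (subtrees \<times> nontrivial)
      \<subseteq> {T \<in> nontrivial. length (children T) \<noteq> 1}"
  proof clarify
    fix c T assume "c \<in> subtrees" "T \<in> nontrivial"
    then show "Node (label c + label T) (c # children T) \<in> nontrivial \<and>
        length (children (Node (label c + label T) (c # children T))) \<noteq> 1"
      by (cases T) (auto simp: nontrivial_iff)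
  qed
  show "(\<lambda>T. (hd (children T), Node (label T - label (hd (children T))) (tl (children T))))
      ` {T \<in> nontrivial. length (children T) \<noteq> 1} \<subseteq> subtrees \<times> nontrivial"
  proof clarify
    fix T assume T: "T \<in> nontrivial" "length (children T) \<noteq> 1"
    obtain l c ts where "T = Node l (c # ts)"
      using T by (cases T, cases "children T") (auto simp: nontrivial_iff)
    then show "hd (children T) \<in> subtrees \<and>
        Node (label T - label (hd (children T))) (tl (children T)) \<in> nontrivial"
      using T by (auto simp: nontrivial_iff)
  qed
qed

text \<open>Either the root has a single child or its leftmost subtree can be detached;
  \<open>fps_X\<close> accounts for the edge to the leftmost child.\<close>

lemma gf_nontrivial:
  "gf edges nontrivial w = fps_X * (gf edges subtrees (\<lambda>c. w (Node (Suc (label c)) [c]))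
     + gf (\<lambda>(c, T). edges c + edges T) (subtrees \<times> nontrivial)
         (\<lambda>(c, T). w (Node (label c + label T) (c # children T))))"
proof -
  let ?g = "\<lambda>(c, T). Node (label c + label T) (c # children T)"
  have "gf edges nontrivial w = gf edges {T \<in> nontrivial. length (children T) = 1} w
      + gf edges {T \<in> nontrivial. length (children T) \<noteq> 1} w"
    using nontrivial_subset_subtrees
    by (subst gf_Un[symmetric]) (auto intro!: graded_edges arg_cong[where f = "\<lambda>S. gf edges S w"])
  also have "gf edges {T \<in> nontrivial. length (children T) = 1} w
      = gf (\<lambda>c. Suc (edges c)) subtrees (\<lambda>c. w (Node (Suc (label c)) [c]))"
    by (rule gf_bij[OF bij_betw_plant]) (simp add: edges_Node num_nodes_eq_Suc_edges)
  also have "gf edges {T \<in> nontrivial. length (children T) \<noteq> 1} w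
      = gf (\<lambda>p. Suc ((\<lambda>(c, T). edges c + edges T) p)) (subtrees \<times> nontrivial) (\<lambda>p. w (?g p))"
  proof (rule gf_bij[OF bij_betw_graft])
    fix p assume "p \<in> subtrees \<times> nontrivial"
    then show "edges (?g p) = Suc ((\<lambda>(c, T). edges c + edges T) p)"
      by (cases p; cases "snd p") (auto simp: edges_Node num_nodes_eq_Suc_edges)
  qed
  finally show ?thesis
    by (simp add: gf_Suc distrib_left case_prod_unfold)
qed

text \<open>\<open>open_node\<close> inspects the children of a node, never its own label.\<close>

lemma num_open_Node_indep: "num_open (Node l ts) = num_open (Node l' ts)"
  by (simp add: num_open_def open_node_def)

text \<open>The rightmost child of the root remains that of \<open>T\<close>, so the path below the
  root and the status of the root are preserved.\<close>

lemma num_open_graft: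
  assumes "children T \<noteq> []"
  shows "num_open (Node l (c # children T)) = num_open T"
  using assms by (cases T) (simp add: num_open_def open_node_def)

text \<open>The path gains a new root, open exactly when \<open>c\<close> is a moderate non-leaf. A
  leaf \<open>c\<close> is itself an open node here, although \<open>num_open\<close> of the trivial
  tree is \<open>0\<close>.\<close>

lemma num_open_plant:
  "num_open (Node l [c]) = (if children c = [] then 1 else num_open c + (if moderate c then 1 else 0))"
  by (cases c) (auto simp: num_open_def open_node_def)

subsection \<open>The functional equation\<close>

text \<open>This is F(x, y). Its arguments range over any integral domain, so that \<open>x\<close>
  can be a power series in the kernel method and a polynomial variable when coefficients are
  extracted.\<close>

definition tree_gf :: "'a::idom \<Rightarrow> 'a \<Rightarrow> 'a fps" where
  "tree_gf x y = gf edges nontrivial (\<lambda>T. x ^ root_label T * y ^ num_open T)"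

text \<open>The divided difference (F(x, y) - F(1, y)) / (x - 1), written without division.\<close>

definition delta_gf :: "'a::idom \<Rightarrow> 'a \<Rightarrow> 'a fps" where
  "delta_gf x y = gf edges nontrivial (\<lambda>T. (\<Sum>i<root_label T. x ^ i) * y ^ num_open T)"

lemma delta_gf_times: "fps_const (x - 1) * delta_gf x y = tree_gf x y - tree_gf 1 y"
  unfolding delta_gf_def tree_gf_def gf_diff[symmetric] gf_cmult[symmetric]
proof (rule gf_cong)
  fix T
  have "(x - 1) * ((\<Sum>i<root_label T. x ^ i) * y ^ num_open T) = (x ^ root_label T - 1) * y ^ num_open T"
    by (simp only: power_diff_1_eq mult.assoc)
  then show "(x - 1) * ((\<Sum>i<root_label T. x ^ i) * y ^ num_open T)
      = x ^ root_label T * y ^ num_open T - 1 ^ root_label T * y ^ num_open T"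
    by (simp add: left_diff_distrib)
qed

text \<open>As \<open>label U\<close> is one more than the child sum, the relabelled root is
  moderate exactly for \<open>i < label U\<close>.\<close>

lemma num_open_plant_relabel:
  assumes "U \<in> nontrivial" "i \<le> label U"
  shows "num_open (Node l [Node i (children U)]) = num_open U + (if i < label U then 1 else 0)"
proof (cases U)
  case (Node k ts)
  then have "moderate (Node i ts) \<longleftrightarrow> i < k" "ts \<noteq> []"
    using assms by (auto simp: moderate_def excessive_def nontrivial_iff child_sum_Node)
  then show ?thesis
    using Node num_open_Node_indep[of i ts k] by (auto simp: num_open_plant)
qed

text \<open>Planting a leaf gives \<open>x * y\<close>. Planting a tree with lowered root label
  creates an open node, hence the factor \<open>y\<close> at \<open>delta_gf x y\<close>; with the
  full label it creates none. A grafted leftmost subtree affects only the root label, so its series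
  is taken at \<open>y = 1\<close>.\<close>

lemma tree_gf_decomposition:
  "tree_gf x y = fps_X * (fps_const x * (fps_const y + fps_const y * delta_gf x y + tree_gf x y)
     + (1 + delta_gf x 1 + tree_gf x 1) * tree_gf x y)"
proof -
  have plant: "gf edges subtrees (\<lambda>c. x ^ Suc (label c) * y ^ num_open (Node (Suc (label c)) [c]))
      = fps_const x * (fps_const y + fps_const y * delta_gf x y + tree_gf x y)"
  proof -
    have "(\<Sum>i\<le>label U. x ^ Suc i * y ^ num_open (Node (Suc i) [Node i (children U)]))
        = x * (y * ((\<Sum>i<label U. x ^ i) * y ^ num_open U) + x ^ label U * y ^ num_open U)"
      if U: "U \<in> nontrivial" for U
    proof -
      have "(\<Sum>i\<le>label U. x ^ Suc i * y ^ num_open (Node (Suc i) [Node i (children U)]))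
          = (\<Sum>i<label U. x ^ Suc i * y ^ num_open (Node (Suc i) [Node i (children U)]))
            + x ^ Suc (label U) * y ^ num_open (Node (Suc (label U)) [Node (label U) (children U)])"
        by (simp flip: lessThan_Suc_atMost)
      also have "\<dots> = (\<Sum>i<label U. x ^ Suc i * y ^ Suc (num_open U)) + x ^ Suc (label U) * y ^ num_open U"
        using U num_open_plant_relabel[OF U order_refl] by (simp add: num_open_plant_relabel)
      also have "\<dots> = x * (y * ((\<Sum>i<label U. x ^ i) * y ^ num_open U) + x ^ label U * y ^ num_open U)"
        by (simp add: sum_distrib_left sum_distrib_right algebra_simps)
      finally show ?thesis .
    qed
    then have "gf edges nontrivial
        (\<lambda>U. \<Sum>i\<le>label U. x ^ Suc i * y ^ num_open (Node (Suc i) [Node i (children U)]))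
        = fps_const x * (fps_const y * delta_gf x y + tree_gf x y)"
      unfolding delta_gf_def tree_gf_def root_label_def
      by (simp only: gf_cmult[symmetric] gf_add[symmetric] cong: gf_cong)
    then show ?thesis
      by (subst gf_subtrees) (simp add: num_open_plant algebra_simps)
  qed
  have "gf edges subtrees (\<lambda>c. x ^ label c) = 1 + (delta_gf x 1 + tree_gf x 1)"
    by (subst gf_subtrees)
      (simp add: delta_gf_def tree_gf_def root_label_def gf_add[symmetric] flip: lessThan_Suc_atMost)
  then have graft: "gf (\<lambda>(c, T). edges c + edges T) (subtrees \<times> nontrivial)
      (\<lambda>(c, T). x ^ label c * (x ^ label T * y ^ num_open T)) = (1 + delta_gf x 1 + tree_gf x 1) * tree_gf x y"
    by (subst gf_Times[OF graded_subtrees graded_nontrivial])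
      (simp add: tree_gf_def root_label_def add.assoc)
  have "tree_gf x y = fps_X *
      (gf edges subtrees (\<lambda>c. x ^ Suc (label c) * y ^ num_open (Node (Suc (label c)) [c]))
      + gf (\<lambda>(c, T). edges c + edges T) (subtrees \<times> nontrivial)
      (\<lambda>(c, T). x ^ (label c + label T) * y ^ num_open (Node (label c + label T) (c # children T))))"
    unfolding tree_gf_def root_label_def by (subst gf_nontrivial) (simp only: ltree.sel)
  also note plant
  also have "gf (\<lambda>(c, T). edges c + edges T) (subtrees \<times> nontrivial)
      (\<lambda>(c, T). x ^ (label c + label T) * y ^ num_open (Node (label c + label T) (c # children T)))
      = gf (\<lambda>(c, T). edges c + edges T) (subtrees \<times> nontrivial)
      (\<lambda>(c, T). x ^ label c * (x ^ label T * y ^ num_open T))"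
    by (rule gf_cong) (auto simp: num_open_graft nontrivial_def power_add mult.assoc)
  also note graft
  finally show ?thesis .
qed

lemma tree_gf_nth_0 [simp]: "tree_gf x y $ 0 = 0"
  by (subst tree_gf_decomposition) simp

lemma tree_gf_nth_1 [simp]: "tree_gf x y $ Suc 0 = x * y"
proof -
  have "edges T \<noteq> 0" if "T \<in> nontrivial" for T
    using that by (cases T) (auto simp: nontrivial_def edges_Node)
  then have "{T. T \<in> nontrivial \<and> edges T = 0} = {}"
    by blast
  then have "delta_gf x y $ 0 = 0"
    by (simp only: delta_gf_def gf_nth sum.empty)
  then show ?thesis
    by (subst tree_gf_decomposition) simp
qed

text \<open>Multiplying the decomposition by \<open>X - 1\<close> clears both divided differences;
  then the terms with \<open>tree_gf x y\<close> are collected.\<close>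

lemma tree_gf_kernel_expanded:
  fixes x y :: "'a::idom"
  defines "X \<equiv> fps_const x" and "Y \<equiv> fps_const y"
  shows "tree_gf x y * (X - 1 - fps_X * (X - 1 + tree_gf x 1 - tree_gf 1 1 + (X - 1) * tree_gf x 1)
      - fps_X * X * (X - 1) - fps_X * X * Y) = fps_X * X * Y * (X - 1 - tree_gf 1 y)"
proof -
  have D: "(X - 1) * delta_gf x z = tree_gf x z - tree_gf 1 z" for z
    using delta_gf_times[of x z] by (simp add: X_def flip: fps_const_sub)
  have eliminate: "G * (X - 1 - t * (X - 1 + B - C + (X - 1) * B) - t * X * (X - 1) - t * X * Y) = t * X * Y * (X - 1 - A)"
    if "G = t * (X * (Y + Y * D + G) + (1 + D' + B) * G)" "(X - 1) * D = G - A" "(X - 1) * D' = B - C"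
    for G t A B C D D' :: "'a fps"
    using that by algebra
  show ?thesis
    by (rule eliminate[OF tree_gf_decomposition[of x y, folded X_def Y_def] D D])
qed

lemma tree_gf_quadratic:
  fixes x :: "'a::idom"
  defines "X \<equiv> fps_const x"
  shows "tree_gf x 1 * ((X - 1) * (1 - fps_X) + fps_X * tree_gf 1 1)
    = fps_X * X * (tree_gf x 1 ^ 2 + (X - 1) - tree_gf 1 1 + X * tree_gf x 1)"
proof -
  have eliminate: "B * ((X - 1) * (1 - t) + t * C) = t * X * (B ^ 2 + (X - 1) - C + X * B)"
    if "B * (X - 1 - t * (X - 1 + B - C + (X - 1) * B) - t * X * (X - 1) - t * X * 1) = t * X * 1 * (X - 1 - C)"
    for t B C :: "'a fps"
    using that by algebra
  show ?thesis
    by (rule eliminate) (use tree_gf_kernel_expanded[of x 1] in \<open>simp add: X_def\<close>)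
qed

lemma tree_gf_kernel:
  fixes x y :: "'a::idom"
  defines "X \<equiv> fps_const x" and "Y \<equiv> fps_const y"
  assumes "x \<noteq> 0"
  shows "tree_gf x y * (X - 1 - tree_gf 1 1 - (Y - 1) * tree_gf x 1) = Y * tree_gf x 1 * (X - 1 - tree_gf 1 y)"
proof -
  \<comment> \<open>Multiply the first equation by \<open>B\<close>: by the second one,
    \<open>B\<close> times the coefficient of \<open>G\<close> equals
    \<open>t * X * (X - 1 - C - (Y - 1) * B)\<close>.\<close>
  have eliminate: "t * X * (G * (X - 1 - C - (Y - 1) * B)) = t * X * (Y * B * (X - 1 - A))"
    if "G * (X - 1 - t * (X - 1 + B - C + (X - 1) * B) - t * X * (X - 1) - t * X * Y) = t * X * Y * (X - 1 - A)"
       "B * ((X - 1) * (1 - t) + t * C) = t * X * (B ^ 2 + (X - 1) - C + X * B)"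
    for G t A B C :: "'a fps"
    using that by algebra
  have "fps_X * X * (tree_gf x y * (X - 1 - tree_gf 1 1 - (Y - 1) * tree_gf x 1))
      = fps_X * X * (Y * tree_gf x 1 * (X - 1 - tree_gf 1 y))"
    unfolding X_def Y_def
    by (rule eliminate[unfolded X_def Y_def, OF tree_gf_kernel_expanded tree_gf_quadratic])
  then show ?thesis
    using assms by (simp add: X_def)
qed

subsection \<open>The kernel method\<close>

text \<open>\<open>diag\<close> identifies the two variables of a power series with power series coefficients; it
  makes sense of substituting a power series for \<open>x\<close>.\<close>

definition diag :: "'a::comm_ring_1 fps fps \<Rightarrow> 'a fps" where
  "diag f = Abs_fps (\<lambda>n. \<Sum>i = 0..n. f $ i $ (n - i))"

lemma diag_nth: "diag f $ n = (\<Sum>i = 0..n. f $ i $ (n - i))"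
  by (simp add: diag_def)

lemma diag_add [simp]: "diag (f + g) = diag f + diag g"
  by (rule fps_ext) (simp add: diag_nth sum.distrib)

lemma diag_diff [simp]: "diag (f - g) = diag f - diag g"
  by (rule fps_ext) (simp add: diag_nth sum_subtractf)

lemma diag_fps_const [simp]: "diag (fps_const c) = c"
proof (rule fps_ext)
  fix n
  have "(\<Sum>i = 0..n. fps_const c $ i $ (n - i)) = (\<Sum>i = 0..n. if i = 0 then c $ n else 0)"
    by (rule sum.cong) auto
  then show "diag (fps_const c) $ n = c $ n"
    by (simp add: diag_nth)
qed

lemma diag_1 [simp]: "diag 1 = 1"
  using diag_fps_const[of 1] by simp

lemma diag_coeffs_const:
  assumes "\<And>n. f $ n = fps_const (g $ n)"
  shows "diag f = g"
proof (rule fps_ext)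
  fix n
  have "(\<Sum>i = 0..n. f $ i $ (n - i)) = (\<Sum>i = 0..n. if i = n then g $ n else 0)"
    by (rule sum.cong) (auto simp: assms)
  then show "diag f $ n = g $ n"
    by (simp add: diag_nth)
qed

lemma diag_X [simp]: "diag fps_X = fps_X"
  by (rule diag_coeffs_const) (simp add: fps_X_def)

lemma diag_mult [simp]: "diag (f * g) = diag f * diag g"
proof (rule fps_ext)
  fix n
  let ?h = "\<lambda>i j k l. f $ i $ j * g $ k $ l"
  have "diag (f * g) $ n = (\<Sum>m = 0..n. \<Sum>i = 0..m. \<Sum>j = 0..n - m. ?h i j (m - i) (n - m - j))"
    by (simp add: diag_nth fps_mult_nth fps_sum_nth)
  also have "\<dots> = (\<Sum>(m, i, j)\<in>(SIGMA m:{0..n}. {0..m} \<times> {0..n - m}). ?h i j (m - i) (n - m - j))"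
    by (simp add: sum.Sigma sum.cartesian_product)
  also have "\<dots> = (\<Sum>(m, i, k)\<in>(SIGMA m:{0..n}. {0..m} \<times> {0..n - m}). ?h i (m - i) k (n - m - k))"
    \<comment> \<open>Terms are regrouped by the total degree \<open>i + j\<close> coming from
      \<open>f\<close> instead of the outer degree \<open>m\<close>; the map is its own
      inverse.\<close>
    by (rule sum.reindex_bij_witness[where
          i = "\<lambda>(m, i, k). (i + k, i, m - i)" and j = "\<lambda>(m, i, j). (i + j, i, m - i)"])
       (auto simp: algebra_simps)
  also have "\<dots> = (\<Sum>m = 0..n. \<Sum>i = 0..m. \<Sum>k = 0..n - m. ?h i (m - i) k (n - m - k))"
    by (simp add: sum.Sigma sum.cartesian_product)
  also have "\<dots> = (diag f * diag g) $ n"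
    by (simp add: diag_nth fps_mult_nth sum_product)
  finally show "diag (f * g) $ n = (diag f * diag g) $ n" .
qed

lemma diag_power [simp]: "diag (f ^ n) = diag f ^ n"
  by (induction n) simp_all

text \<open>For constant arguments all coefficients are constant, so \<open>diag\<close> merely
  renames the outer variable.\<close>

lemma diag_tree_gf_const: "diag (tree_gf (fps_const x) (fps_const y)) = tree_gf x y"
proof (rule diag_coeffs_const)
  fix n
  have sum: "sum (\<lambda>a. fps_const (w a)) S = fps_const (sum w S)" for w :: "ltree \<Rightarrow> 'a" and S
    by (rule fps_ext) (simp add: fps_sum_nth)
  show "tree_gf (fps_const x) (fps_const y) $ n = fps_const (tree_gf x y $ n)"
    by (simp add: tree_gf_def gf_nth fps_const_power sum)
qed

text \<open>The tree with one edge makes the coefficient of \<open>fps_X\<close> equal to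
  \<open>x $ 0 * y $ 0\<close>.\<close>

lemma diag_tree_gf_neq_0:
  assumes "x $ 0 * y $ 0 \<noteq> 0"
  shows "diag (tree_gf x y) \<noteq> 0"
proof
  assume "diag (tree_gf x y) = 0"
  then have "diag (tree_gf x y) $ 1 = 0"
    by simp
  then show False
    using assms by (simp add: diag_nth)
qed

lemma tree_gf_marginals:
  fixes y :: "'a::idom"
  assumes "y \<noteq> 0" "y \<noteq> 1"
  shows "tree_gf 1 y = tree_gf y 1"
proof -
  define A where "A = tree_gf 1 y"
  define B where "B = tree_gf y 1"
  define C where "C = (tree_gf 1 1 :: 'a fps)"
  define Y where "Y = fps_const y"
  \<comment> \<open>\<open>b\<close> plays the role of B(1 + A(y)).\<close>
  define b where "b = diag (tree_gf (1 + A) 1)"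
  have A0: "(1 + A) $ 0 = 1"
    by (simp add: A_def)
  then have "1 + A \<noteq> 0"
    by (metis fps_zero_nth zero_neq_one)
  have D: "diag (tree_gf 1 Y) = A" "diag (tree_gf 1 1) = C"
    using diag_tree_gf_const[of 1 y] diag_tree_gf_const[of "1::'a" 1] by (simp_all add: A_def C_def Y_def)
  \<comment> \<open>At \<open>x = 1 + A\<close> the last factor on the right becomes
    \<open>A - A\<close> under \<open>diag\<close>.\<close>
  have "diag (tree_gf (1 + A) Y * (fps_const (1 + A) - 1 - tree_gf 1 1 - (fps_const Y - 1) * tree_gf (1 + A) 1))
      = diag (fps_const Y * tree_gf (1 + A) 1 * (fps_const (1 + A) - 1 - tree_gf 1 Y))"
    using \<open>1 + A \<noteq> 0\<close> by (subst tree_gf_kernel) simp_all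
  then have "diag (tree_gf (1 + A) Y) * (A - C - (Y - 1) * b) = 0"
    by (simp del: fps_const_add add: D b_def)
  moreover have "diag (tree_gf (1 + A) Y) \<noteq> 0"
    using A0 assms by (intro diag_tree_gf_neq_0) (simp add: Y_def)
  ultimately have kernel: "A - C - (Y - 1) * b = 0"
    by simp
  have "diag (tree_gf (1 + A) 1 * ((fps_const (1 + A) - 1) * (1 - fps_X) + fps_X * tree_gf 1 1))
      = diag (fps_X * fps_const (1 + A) * (tree_gf (1 + A) 1 ^ 2 + (fps_const (1 + A) - 1) - tree_gf 1 1
          + fps_const (1 + A) * tree_gf (1 + A) 1))"
    by (subst tree_gf_quadratic) simp
  then have quadratic_b: "b * (A * (1 - fps_X) + fps_X * C) = fps_X * (1 + A) * (b ^ 2 + A - C + (1 + A) * b)"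
    by (simp del: fps_const_add add: D b_def)
  have quadratic_B: "B * ((Y - 1) * (1 - fps_X) + fps_X * C) = fps_X * Y * (B ^ 2 + (Y - 1) - C + Y * B)"
    unfolding B_def C_def Y_def by (rule tree_gf_quadratic)
  \<comment> \<open>The cofactor of \<open>A - B\<close> when \<open>quadratic_B\<close> is
    subtracted from the same equation for \<open>A\<close>.\<close>
  let ?L = "fps_X * Y * (A + B) + fps_X * Y ^ 2 - (Y - 1) * (1 - fps_X) - fps_X * C"
  \<comment> \<open>Substituting \<open>A - C = (Y - 1) * b\<close> makes the second equation
    divisible by \<open>b\<close>. Multiplying the quotient by \<open>Y - 1\<close> and replacing
    \<open>(Y - 1) * b\<close> by \<open>A - C\<close> yields the quadratic equation for
    \<open>A\<close>.\<close>
  have conclude: "b * ((A - B) * (t * Y * (A + B) + t * Y ^ 2 - (Y - 1) * (1 - t) - t * C)) = 0"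
    if "A - C - (Y - 1) * b = 0"
       "b * (A * (1 - t) + t * C) = t * (1 + A) * (b ^ 2 + A - C + (1 + A) * b)"
       "B * ((Y - 1) * (1 - t) + t * C) = t * Y * (B ^ 2 + (Y - 1) - C + Y * B)"
    for A B C Y b t :: "'a fps"
    using that by algebra
  have "b * ((A - B) * ?L) = 0"
    by (rule conclude[OF kernel quadratic_b quadratic_B])
  moreover have "b \<noteq> 0"
    unfolding b_def using A0 by (intro diag_tree_gf_neq_0) simp
  \<comment> \<open>The constant term of \<open>?L\<close> is \<open>1 - y\<close>.\<close>
  moreover have "?L $ 0 \<noteq> 0"
    using assms by (simp add: Y_def)
  then have "?L \<noteq> 0"
    by (metis fps_zero_nth)
  ultimately have "A = B"
    by simp
  then show ?thesis
    by (simp add: A_def B_def)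
qed

lemma tree_gf_sym:
  fixes x y :: "'a::idom"
  assumes "x \<noteq> 0" "x \<noteq> 1" "y \<noteq> 0" "y \<noteq> 1"
  shows "tree_gf x y = tree_gf y x"
proof -
  let ?t = "fps_X :: 'a fps"
  let ?K = "\<lambda>x y. fps_const x - 1 - tree_gf 1 1 - (fps_const y - 1) * tree_gf x 1"
  \<comment> \<open>After multiplication by both kernels the difference is a consequence of the two
    quadratic equations, cross-multiplied so that the products of \<open>A * (X - 1)\<close> and
    \<open>B * (Y - 1)\<close> cancel; this leaves the factor \<open>t\<close>.\<close>
  have conclude: "t * ((F - G) * ((X - 1 - C - (Y - 1) * A) * (Y - 1 - C - (X - 1) * B))) = 0"
    if "F * (X - 1 - C - (Y - 1) * A) = Y * A * (X - 1 - B)"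
       "G * (Y - 1 - C - (X - 1) * B) = X * B * (Y - 1 - A)"
       "A * ((X - 1) * (1 - t) + t * C) = t * X * (A ^ 2 + (X - 1) - C + X * A)"
       "B * ((Y - 1) * (1 - t) + t * C) = t * Y * (B ^ 2 + (Y - 1) - C + Y * B)"
    for A B C F G X Y t :: "'a fps"
    using that by algebra
  have "?t * ((tree_gf x y - tree_gf y x) * (?K x y * ?K y x)) = 0"
  proof (rule conclude)
    show "tree_gf x y * ?K x y = fps_const y * tree_gf x 1 * (fps_const x - 1 - tree_gf y 1)"
      using assms by (simp add: tree_gf_kernel tree_gf_marginals)
    show "tree_gf y x * ?K y x = fps_const x * tree_gf y 1 * (fps_const y - 1 - tree_gf x 1)"
      using assms by (simp add: tree_gf_kernel tree_gf_marginals)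
  qed (rule tree_gf_quadratic)+
  \<comment> \<open>The constant term of the kernel is \<open>x - 1\<close>.\<close>
  moreover have "?K x y \<noteq> 0" if "x \<noteq> 1" for x y :: 'a
  proof -
    have "?K x y $ 0 \<noteq> 0"
      using that by simp
    then show ?thesis
      by (metis fps_zero_nth)
  qed
  ultimately show ?thesis
    using assms by simp
qed

subsection \<open>Extracting coefficients\<close>

text \<open>Over \<open>int poly poly\<close>, \<open>monom (monom 1 1) 0\<close> is the inner
  variable and \<open>monom 1 1\<close> the outer one; \<open>i\<close> is the inner exponent and
  \<open>j\<close> the outer one in both equations.\<close>

lemma tree_gf_coeffs:
  "coeff (coeff (tree_gf (monom (monom 1 1) 0) (monom 1 1) $ m) j) i
     = int (card {T \<in> nontrivial. edges T = m \<and> root_label T = i \<and> num_open T = j})"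
  "coeff (coeff (tree_gf (monom 1 1) (monom (monom 1 1) 0) $ m) j) i
     = int (card {T \<in> nontrivial. edges T = m \<and> num_open T = i \<and> root_label T = j})"
proof -
  let ?S = "{T. T \<in> nontrivial \<and> edges T = m}"
  have fin: "finite ?S"
    using graded_nontrivial by (simp add: graded_def)
  have count: "coeff (coeff (\<Sum>T\<in>?S. monom (monom 1 (p T)) (q T)) j) i
      = int (card {T \<in> nontrivial. edges T = m \<and> p T = i \<and> q T = j})" for p q :: "ltree \<Rightarrow> nat"
  proof -
    have "coeff (coeff (\<Sum>T\<in>?S. monom (monom (1::int) (p T)) (q T)) j) i
        = (\<Sum>T\<in>?S. if p T = i \<and> q T = j then 1 else 0)"
      by (auto simp: coeff_sum intro!: sum.cong)
    also have "\<dots> = int (card (?S \<inter> {T. p T = i \<and> q T = j}))"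
      using fin by (simp add: sum.If_cases)
    also have "?S \<inter> {T. p T = i \<and> q T = j} = {T \<in> nontrivial. edges T = m \<and> p T = i \<and> q T = j}"
      by auto
    finally show ?thesis .
  qed
  show "coeff (coeff (tree_gf (monom (monom 1 1) 0) (monom 1 1) $ m) j) i
     = int (card {T \<in> nontrivial. edges T = m \<and> root_label T = i \<and> num_open T = j})"
    unfolding tree_gf_def gf_nth by (subst count[symmetric]) (simp add: monom_power mult_monom)
  show "coeff (coeff (tree_gf (monom 1 1) (monom (monom 1 1) 0) $ m) j) i
     = int (card {T \<in> nontrivial. edges T = m \<and> num_open T = i \<and> root_label T = j})"
    unfolding tree_gf_def gf_nth by (subst count[symmetric]) (simp add: monom_power mult_monom)
qed

lemma card_root_open:
  "card {T \<in> beta01_trees n. root_label T = i \<and> num_open T = j}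
     = card {T \<in> beta01_trees n. num_open T = i \<and> root_label T = j}"
proof (cases "n = 1")
  case True
  have "root_label T = 0 \<and> num_open T = 0" if "T \<in> beta01_trees n" for T
  proof (cases T)
    case (Node l ts)
    then have "ts = []"
      using that True by (simp add: beta01_trees_def)
    then show ?thesis
      using that Node by (simp add: beta01_trees_def beta01_tree_def root_label_def num_open_def)
  qed
  then have "{T \<in> beta01_trees n. root_label T = i \<and> num_open T = j}
      = {T \<in> beta01_trees n. num_open T = i \<and> root_label T = j}"
    by force
  then show ?thesis
    by simp
next
  case False
  have "T \<in> nontrivial \<and> n = Suc (edges T)" if "T \<in> beta01_trees n" for T
    using that False by (cases T) (auto simp: beta01_trees_def nontrivial_def edges_Node)
  then have eq: "{T \<in> beta01_trees n. P T} = (if n = 0 then {} else {T \<in> nontrivial. edges T = n - 1 \<and> P T})" for P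
    by (auto simp: beta01_trees_def nontrivial_def num_nodes_eq_Suc_edges)
  \<comment> \<open>Two independent variables satisfy the conditions of \<open>tree_gf_sym\<close>,
    and comparing coefficients then gives the counts.\<close>
  have "tree_gf (monom (monom 1 1) 0) (monom 1 1) = tree_gf (monom 1 1) (monom (monom (1::int) 1) 0)"
  proof (rule tree_gf_sym)
    show "monom (monom (1::int) 1) 0 \<noteq> 1" "monom (1::int poly) 1 \<noteq> 1"
      by (simp_all add: one_poly_def[symmetric] monom_eq_1_iff)
  qed simp_all
  then show ?thesis
    unfolding eq using tree_gf_coeffs[of "n - 1" j i] by simp
qed

text \<open>Grouping by values expresses the sum through fibre sizes alone, since the range consists
  of the values with non-empty fibre. This carries the counting result to an arbitrary
  semiring.\<close>

lemma sum_eq_if_fibres_eq: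
  assumes "finite S" and "\<And>p. card {T \<in> S. f T = p} = card {T \<in> S. g T = p}"
  shows "(\<Sum>T\<in>S. h (f T)) = (\<Sum>T\<in>S. h (g T) :: 'a::semiring_1)"
proof -
  have fibres: "(\<Sum>T\<in>S. h (k T)) = (\<Sum>p\<in>k ` S. of_nat (card {T \<in> S. k T = p}) * h p)" for k
  proof -
    have "(\<Sum>T\<in>S. h (k T)) = (\<Sum>p\<in>k ` S. \<Sum>T | T \<in> S \<and> k T = p. h (k T))"
      using assms(1) by (rule sum.image_gen)
    also have "\<dots> = (\<Sum>p\<in>k ` S. of_nat (card {T \<in> S. k T = p}) * h p)"
      by (rule sum.cong) simp_all
    finally show ?thesis .
  qed
  have image: "k ` S = {p. card {T \<in> S. k T = p} \<noteq> 0}" for k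
    using assms(1) by (auto simp: card_eq_0_iff)
  show ?thesis
    unfolding fibres image assms(2) ..
qed

theorem theorem11:
  fixes n :: nat and x y :: "'a::comm_semiring_1"
  shows "(\<forall>i j. card {T \<in> beta01_trees n. root_label T = i \<and> num_open T = j}
              = card {T \<in> beta01_trees n. num_open T = i \<and> root_label T = j})
       \<and> (\<Sum>T\<in>beta01_trees n. x ^ root_label T * y ^ num_open T)
         = (\<Sum>T\<in>beta01_trees n. x ^ num_open T * y ^ root_label T)"
proof (intro conjI allI card_root_open)
  have "(\<Sum>T\<in>beta01_trees n. (\<lambda>(i, j). x ^ i * y ^ j) (root_label T, num_open T))
      = (\<Sum>T\<in>beta01_trees n. (\<lambda>(i, j). x ^ i * y ^ j) (num_open T, root_label T))"
    by (rule sum_eq_if_fibres_eq) (auto simp: finite_beta01_trees card_root_open)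
  then show "(\<Sum>T\<in>beta01_trees n. x ^ root_label T * y ^ num_open T)
         = (\<Sum>T\<in>beta01_trees n. x ^ num_open T * y ^ root_label T)"
    by simp
qed

end
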